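(* Let $\alpha\in(-\pi/2,\pi/2)$, and let the triple $(w(x,t),\omega,s)$, with $w\in C_{\mathrm{per}}([-\pi,\pi]\times[0,2\pi];\mathbb{C})$, $\omega>0$, $s\in\mathbb{R}$, be a solution of the self-consistency equation $$2\omega e^{i\alpha} w(x,t)-\mathcal{G}\,\mathcal{U}(w(x,t),s)=0.$$ Let $u(x,t)=\mathcal{U}(w(x,t),s)$, $a(x,t)=u(x,\omega t)$, $T=2\pi/\omega$, $\Omega=s\omega$, and $z(x,t)=a(x,t)e^{i\Omega t}$. Let $Z(t)$ and $\Omega_{\mathrm{eff}}(x)$ be the global order parameter and the effective frequency associated with $z$, i.e. $$Z(t)=\frac{1}{2\pi}\int_{-\pi}^{\pi}z(x,t)\,dx,\qquad \Omega_{\mathrm{eff}}(x)=-\mathrm{Im}\left(e^{i\alpha}\lim_{\tau\to\infty}\frac1\tau\int_0^\tau z(x,t)\,(\mathcal{G}\overline{z})(x,t)\,dt\right).$$ Then $$|Z(t)|=\frac{1}{2\pi}\left|\int_{-\pi}^{\pi}a(x,t)\,dx\right|=\frac{1}{2\pi}\left|\int_{-\pi}^{\pi}u(x,\omega t)\,dx\right|$$ and $$\Omega_{\mathrm{eff}}(x)=-\mathrm{Im}\left(\frac1T\int_0^T e^{i\alpha}a(x,t)(\mathcal{G}\overline{a})(x,t)\,dt\right)=-2\omega\,\mathrm{Im}\left(\frac{1}{2\pi}\int_0^{2\pi}u(x,t)\,\overline{w}(x,t)\,dt\right).$$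
   Context: $C_{\mathrm{per}}([-\pi,\pi]\times[0,2\pi];\mathbb{C})$ is the space of continuous complex-valued functions $2\pi$-periodic in each of $x$ and $t$. The coupling kernel $G:\mathbb{R}\to\mathbb{R}$ is a nonconstant continuous even $2\pi$-periodic function, and $(\mathcal{G}u)(x)=\int_{-\pi}^{\pi}G(x-y)u(y)\,dy$, acting in the variable $x$ for each fixed $t$. The operator $\mathcal{U}$ acts in the variable $t$ for each fixed $x$: $\mathcal{U}(w(x,t),s)$ means $\mathcal{U}(w(x,\cdot),s)(t)$. Definition of the solution operator $\mathcal{U}: C_{\mathrm{per}}([0,2\pi];\mathbb{C})\times\mathbb{R}\to C^1_{\mathrm{per}}([0,2\pi];\mathbb{C})$ (spaces of $2\pi$-periodic continuous, resp. $C^1$, functions). Given $(w,s)$, consider the complex Riccati equation $\frac{du}{dt} = w(t) - i s u(t) - \overline{w}(t)u^2(t)$. All solutions starting in the closed unit disc $\overline{\mathbb{D}}$ are global and remain in $\overline{\mathbb{D}}$, and the Poincaré map $u(0)\mapsto u(2\pi)$ on $\overline{\mathbb{D}}$ has the form $\mathcal{M}(u)=\frac{e^{i\theta}(u+b)}{\overline{b}u+1}$ with $|b|<1$, $\theta\in(-\pi,\pi]$. Explicitly, $b=-\zeta$ and $e^{i\theta}=\frac{\overline{\zeta}-1}{\zeta-1}e^{i\chi}$, where $\zeta=U(-2\pi)$ with $U$ the solution of the Riccati equation with $U(0)=0$, and $\chi=\Psi(2\pi)$ with $\Psi$ the solution of $\frac{d\Psi}{dt}=-s+2\,\mathrm{Im}(w(t)e^{-i\Psi})$,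 $\Psi(0)=0$. Define $u_0$ by: $u_0=0$ if $b=0$; if $b\neq0$, $u_0=\frac{1}{|b|^2}\left(i\sin(\theta/2)+\sqrt{|b|^2-\sin^2(\theta/2)}\right)b e^{i\theta/2}$ when $|b|>|\sin(\theta/2)|$; $u_0=\frac{1}{|b|^2}\left(i\sin(\theta/2)-i\sqrt{\sin^2(\theta/2)-|b|^2}\right)b e^{i\theta/2}$ when $|b|\le\sin(\theta/2)$; and $u_0=\frac{1}{|b|^2}\left(i\sin(\theta/2)+i\sqrt{\sin^2(\theta/2)-|b|^2}\right)b e^{i\theta/2}$ when $|b|\le-\sin(\theta/2)$. (For $b\ne0$ this is the unique fixed point of $\mathcal{M}$ in $\overline{\mathbb{D}}$ with $|\mathcal{M}'(u_0)|\le1$.) Then $\mathcal{U}(w,s)$ is the ($2\pi$-periodic) solution $u(t)$ of the Riccati equation with $u(0)=u_0$. *)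

theory Defs
  imports "HOL-Analysis.Analysis"
begin

(* Functions on the torus are represented by their doubly periodic extensions to the plane. *)
definition C_per2 :: "(real \<Rightarrow> real \<Rightarrow> complex) set" where
  "C_per2 = {w. continuous_on UNIV (\<lambda>(x, t). w x t) \<and>
     (\<forall>x t. w (x + 2 * pi) t = w x t) \<and> (\<forall>x t. w x (t + 2 * pi) = w x t)}"

definition coupling_kernel :: "(real \<Rightarrow> real) \<Rightarrow> bool" where
  "coupling_kernel G \<longleftrightarrow> continuous_on UNIV G \<and> (\<forall>x. G (- x) = G x) \<and>
     (\<forall>x. G (x + 2 * pi) = G x) \<and> \<not> G constant_on UNIV"

definition coupling_op :: "(real \<Rightarrow> real) \<Rightarrow> (real \<Rightarrow> complex) \<Rightarrow> real \<Rightarrow> complex" where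
  "coupling_op G u x = integral {-pi..pi} (\<lambda>y. complex_of_real (G (x - y)) * u y)"

definition riccati_solution :: "(real \<Rightarrow> complex) \<Rightarrow> real \<Rightarrow> (real \<Rightarrow> complex) \<Rightarrow> bool" where
  "riccati_solution w s u \<longleftrightarrow>
     (\<forall>t. (u has_vector_derivative
        (w t - \<i> * complex_of_real s * u t - cnj (w t) * (u t)\<^sup>2)) (at t))"

(* For continuous w a global solution with given initial value is unique, and it exists when
   cmod c \<le> 1. *)
definition riccati_flow :: "(real \<Rightarrow> complex) \<Rightarrow> real \<Rightarrow> complex \<Rightarrow> real \<Rightarrow> complex" where
  "riccati_flow w s c = (THE u. riccati_solution w s u \<and> u 0 = c)"

(* cis \<circ> phase_flow w s is the solution of the Riccati equation that starts at 1. *)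
definition phase_flow :: "(real \<Rightarrow> complex) \<Rightarrow> real \<Rightarrow> real \<Rightarrow> real" where
  "phase_flow w s = (THE \<Psi>. \<Psi> 0 = 0 \<and>
     (\<forall>t. (\<Psi> has_real_derivative
        (- s + 2 * Im (w t * exp (- \<i> * complex_of_real (\<Psi> t))))) (at t)))"

(* Parameters b and \<theta> of the Poincare map
     u \<mapsto> exp (\<i> * \<theta>) * (u + b) / (cnj b * u + 1)
   taking u(0) to u(2 * pi). They are read off from the conditions that the map sends -b to 0
   and 1 to exp (\<i> * phase_flow w s (2 * pi)). Arg takes its values in (-pi, pi]. *)
definition poincare_b :: "(real \<Rightarrow> complex) \<Rightarrow> real \<Rightarrow> complex" where
  "poincare_b w s = - riccati_flow w s 0 (- 2 * pi)"

definition poincare_theta :: "(real \<Rightarrow> complex) \<Rightarrow> real \<Rightarrow> real" where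
  "poincare_theta w s =
     (let \<zeta> = riccati_flow w s 0 (- 2 * pi); h = phase_flow w s (2 * pi)
      in Arg ((cnj \<zeta> - 1) / (\<zeta> - 1) * exp (\<i> * complex_of_real h)))"

(* For b \<noteq> 0 and \<theta> in (-pi, pi], the fixed point of the above map in the closed unit disc at
   which the modulus of its derivative is at most 1. *)
definition fixed_pt :: "complex \<Rightarrow> real \<Rightarrow> complex" where
  "fixed_pt b \<theta> =
     (let \<sigma> = sin (\<theta> / 2);
          c = b * exp (\<i> * complex_of_real (\<theta> / 2)) / complex_of_real ((cmod b)\<^sup>2)
      in if b = 0 then 0
         else if cmod b > \<bar>\<sigma>\<bar> then
           (\<i> * complex_of_real \<sigma> + complex_of_real (sqrt ((cmod b)\<^sup>2 - \<sigma>\<^sup>2))) * c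
         else if cmod b \<le> \<sigma> then
           (\<i> * complex_of_real \<sigma> - \<i> * complex_of_real (sqrt (\<sigma>\<^sup>2 - (cmod b)\<^sup>2))) * c
         else
           (\<i> * complex_of_real \<sigma> + \<i> * complex_of_real (sqrt (\<sigma>\<^sup>2 - (cmod b)\<^sup>2))) * c)"

definition sol_op :: "(real \<Rightarrow> complex) \<Rightarrow> real \<Rightarrow> real \<Rightarrow> complex" where
  "sol_op w s = riccati_flow w s (fixed_pt (poincare_b w s) (poincare_theta w s))"

definition order_parameter :: "(real \<Rightarrow> real \<Rightarrow> complex) \<Rightarrow> real \<Rightarrow> complex" where
  "order_parameter z t = 1 / (2 * complex_of_real pi) * integral {-pi..pi} (\<lambda>x. z x t)"

definition running_average ::
    "(real \<Rightarrow> real) \<Rightarrow> (real \<Rightarrow> real \<Rightarrow> complex) \<Rightarrow> real \<Rightarrow> real \<Rightarrow> complex" where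
  "running_average G z x \<tau> =
     1 / complex_of_real \<tau> *
       integral {0..\<tau>} (\<lambda>t. z x t * coupling_op G (\<lambda>y. cnj (z y t)) x)"

(* Lim is unspecified if the limit does not exist. *)
definition effective_frequency ::
    "(real \<Rightarrow> real) \<Rightarrow> real \<Rightarrow> (real \<Rightarrow> real \<Rightarrow> complex) \<Rightarrow> real \<Rightarrow> real" where
  "effective_frequency G \<alpha> z x =
     - Im (exp (\<i> * complex_of_real \<alpha>) * Lim at_top (running_average G z x))"

end

theory Submission
  imports Defs
begin

text \<open>The phase factor of \<open>z\<close> cancels in \<open>z * coupling_op G (cnj z)\<close>, and since \<open>G\<close> is real,
  the conjugate of the self-consistency equation turns \<open>coupling_op G (cnj a)\<close> into a multiple
  of \<open>cnj w\<close>. The time average of a continuous periodic function is its mean over a period, so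
  the point is that \<open>sol_op w s\<close> is periodic. For this the Riccati equation is linearised by
  \<open>u = p / q\<close> with \<open>p' = w q - (i s / 2) p\<close> and \<open>q' = (cnj w) p + (i s / 2) q\<close>. The propagator
  of this system lies in SU(1,1), so the Poincare map is a Moebius transformation of the closed
  disc, and its parameters are determined by the preimage of 0 and the image of 1.\<close>

subsection \<open>Global solutions of ordinary differential equations\<close>

lemma has_vector_derivative_affine_arg:
  assumes "(f has_vector_derivative D) (at (c * t + d))"
  shows "((\<lambda>t::real. f (c * t + d)) has_vector_derivative c *\<^sub>R D) (at t)"
proof -
  have "((\<lambda>t. c * t + d) has_vector_derivative c) (at t)"
    by (auto intro!: derivative_eq_intros)
  from vector_diff_chain_at[OF this assms] show ?thesis
    by (simp add: o_def)
qed

lemma antiderivative_exists: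
  fixes f :: "real \<Rightarrow> 'a::banach"
  assumes "continuous_on UNIV f"
  obtains F where "F 0 = 0" "\<And>t. (F has_vector_derivative f t) (at t)"
proof -
  \<comment> \<open>At each \<open>t\<close> at least one of the two integrals is over an empty or
    one-point interval and hence 0, so \<open>F\<close> is the signed integral from 0.\<close>
  define F where "F t = integral {0..t} f - integral {t..0} f" for t
  have "(F has_vector_derivative f t) (at t)" for t
  proof -
    \<comment> \<open>The margin 1 puts both 0 and \<open>t\<close> inside the interval, so the
      derivative within it is the full derivative, and near \<open>t\<close> the local
      antiderivative \<open>g\<close> differs from \<open>F\<close> by a constant.\<close>
    define R where "R = \<bar>t\<bar> + 1"
    obtain g where g: "\<And>x. x \<in> {-R..R} \<Longrightarrow> (g has_vector_derivative f x) (at x within {-R..R})"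
      using antiderivative_continuous[of "-R" R f] assms continuous_on_subset by blast
    have integral_g: "integral {u..v} f = g v - g u" if "u \<le> v" "u \<in> {-R..R}" "v \<in> {-R..R}" for u v
    proof -
      have "(f has_integral g v - g u) {u..v}"
        using that by (intro fundamental_theorem_of_calculus)
          (auto intro: has_vector_derivative_within_subset[OF g])
      then show ?thesis by (rule integral_unique)
    qed
    have F_g: "g x - g 0 = F x" if "x \<in> {-R<..<R}" for x
    proof (cases "x \<ge> 0")
      case True
      have "integral {x..0} f = 0" using True by (cases "x = 0") auto
      then show ?thesis using integral_g[of 0 x] True that by (auto simp: F_def R_def)
    next
      case False
      then show ?thesis using integral_g[of x 0] that by (auto simp: F_def R_def)
    qed
    have "(g has_vector_derivative f t) (at t)"
    proof -
      have "(g has_vector_derivative f t) (at t within {-R<..<R})"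
        by (rule has_vector_derivative_within_subset[OF g]) (auto simp: R_def)
      moreover have "t \<in> {-R<..<R}" by (auto simp: R_def)
      ultimately show ?thesis by (metis at_within_open open_greaterThanLessThan)
    qed
    then have "((\<lambda>x. g x - g 0) has_vector_derivative f t) (at t)"
      by (auto intro!: derivative_eq_intros)
    then show ?thesis
      by (rule has_vector_derivative_transform_within_open[where S="{-R<..<R}"])
        (auto simp: F_g, auto simp: R_def)
  qed
  moreover have "F 0 = 0" by (simp add: F_def)
  ultimately show thesis using that by blast
qed

text \<open>Integrating the bound gives C / K * (exp (K * t) - 1) for positive times, and the -1 is
  dropped. Reflection handles negative times. The gain 1 / K is what turns a Lipschitz bound into a
  contraction for large K.\<close>

lemma norm_antiderivative_exp_bound:
  fixes F :: "real \<Rightarrow> 'a::real_normed_vector"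
  assumes F0: "F 0 = 0" and F: "\<And>t. (F has_vector_derivative f t) (at t)"
    and bound: "\<And>t. norm (f t) \<le> C * exp (K * \<bar>t\<bar>)" and K: "K > 0"
  shows "norm (F t) \<le> C / K * exp (K * \<bar>t\<bar>)"
proof -
  have C: "C \<ge> 0" using order_trans[OF norm_ge_zero[of "f 0"] bound[of 0]] by simp
  have pos: "norm (H t) \<le> C / K * exp (K * t)"
    if "H 0 = 0" "\<And>t. (H has_vector_derivative h t) (at t)"
      "\<And>t. t > 0 \<Longrightarrow> norm (h t) \<le> C * exp (K * t)" "t \<ge> 0" 
    for H :: "real \<Rightarrow> 'a" and h t
  proof (cases "t = 0")
    case True
    then show ?thesis using that C K by simp
  next
    case False
    have "norm (H t - H 0) \<le> C / K * exp (K * t) - C / K * exp (K * 0)"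
    proof (rule differentiable_bound_general)
      show "0 < t" using False that by simp
      show "continuous_on {0..t} H"
        using that(2) by (meson continuous_at_imp_continuous_on has_vector_derivative_continuous)
      show "((\<lambda>x. C / K * exp (K * x)) has_vector_derivative C * exp (K * x)) (at x)" for x
        unfolding has_real_derivative_iff_has_vector_derivative[symmetric]
        using K by (auto intro!: derivative_eq_intros)
    qed (use that K in \<open>auto intro!: continuous_intros\<close>)
    moreover have "C / K * exp (K * 0) \<ge> 0" using C K by simp
    ultimately show ?thesis using \<open>H 0 = 0\<close> by simp
  qed
  show ?thesis
  proof (cases "t \<ge> 0")
    case True
    then show ?thesis using pos[of F f t] F0 F bound by (metis abs_of_nonneg less_imp_le)
  next
    case False
    have "((\<lambda>t. F (- t)) has_vector_derivative - f (- x)) (at x)" for x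
      using has_vector_derivative_affine_arg[of F "f (- x)" "-1" x 0] F by simp
    moreover have "norm (- f (- x)) \<le> C * exp (K * x)" if "x > 0" for x
      using bound[of "- x"] that by simp
    ultimately have "norm (F (- (- t))) \<le> C / K * exp (K * (- t))"
      by (rule pos[where H="\<lambda>t. F (- t)", rotated]) (use False F0 in auto)
    then show ?thesis using False by simp
  qed
qed

text \<open>In the weighted norm \<open>sup \<bar>x t\<bar> * exp (- 2 * L * \<bar>t\<bar>)\<close> the integral operator is a
  contraction on the whole line, so no gluing of local solutions is needed.\<close>

lemma lipschitz_ode_global_solution:
  fixes f :: "real \<Rightarrow> 'a::banach \<Rightarrow> 'a"
  assumes cont: "\<And>x. continuous_on UNIV x \<Longrightarrow> continuous_on UNIV (\<lambda>t. f t (x t))"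
    and lip: "\<And>t x y. norm (f t x - f t y) \<le> L * norm (x - y)"
    and bound: "\<And>t. norm (f t 0) \<le> B" and L: "L > 0"
  obtains x where "x 0 = x0" "\<And>t. (x has_vector_derivative f t (x t)) (at t)"
proof -
  \<comment> \<open>With this \<open>K\<close> the contraction factor L / K is 1/2.\<close>
  define K where "K = 2 * L"
  have K: "K > 0" using L by (simp add: K_def)
  \<comment> \<open>\<open>y\<close> is the rescaled unknown: the candidate solution is exp (K *
    |t|) times \<open>y t\<close>, so the plain sup norm of \<open>y\<close> is the weighted
    norm.\<close>
  define g where "g y t = f t (exp (K * \<bar>t\<bar>) *\<^sub>R y t)" for y :: "real \<Rightarrow> 'a" and t
  define F where
    "F y = (SOME F. F 0 = 0 \<and> (\<forall>t. (F has_vector_derivative g y t) (at t)))" for y :: "real \<Rightarrow> 'a"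
  have F: "F y 0 = 0" "(F y has_vector_derivative g y t) (at t)" if "continuous_on UNIV y" for y t
  proof -
    have "continuous_on UNIV (g y)" unfolding g_def
      by (rule cont) (intro continuous_intros that)
    then have "\<exists>F. F 0 = 0 \<and> (\<forall>t. (F has_vector_derivative g y t) (at t))"
      by (metis antiderivative_exists)
    from someI_ex[OF this] show "F y 0 = 0" "(F y has_vector_derivative g y t) (at t)"
      unfolding F_def by blast+
  qed
  \<comment> \<open>The Picard operator, written for the rescaled unknown.\<close>
  define H where "H y t = exp (- K * \<bar>t\<bar>) *\<^sub>R (x0 + F y t)" for y t
  have H: "H y \<in> bcontfun" if y: "y \<in> bcontfun" for y
  proof -
    have cy: "continuous_on UNIV y" using y by (simp add: bcontfun_def)
    obtain M where M: "\<And>t. norm (y t) \<le> M"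
      using y by (auto simp: bcontfun_def bounded_iff)
    have B0: "B \<ge> 0" using norm_ge_zero[of "f 0 0"] bound[of 0] by linarith
    have "norm (g y t) \<le> (B + L * M) * exp (K * \<bar>t\<bar>)" for t
    proof -
      have "norm (g y t) \<le> norm (f t 0) + norm (g y t - f t 0)" by norm
      also have "\<dots> \<le> B + L * (exp (K * \<bar>t\<bar>) * norm (y t))"
        using bound[of t] lip[of t "exp (K * \<bar>t\<bar>) *\<^sub>R y t" 0] by (simp add: g_def)
      \<comment> \<open>The constant \<open>B\<close> is absorbed into the exponential, which is at
        least 1.\<close>
      also have "\<dots> \<le> B * exp (K * \<bar>t\<bar>) + L * (exp (K * \<bar>t\<bar>) * M)"
        using M[of t] L B0 K by (intro add_mono mult_left_mono) (auto simp: mult_le_cancel_left1)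
      finally show ?thesis by (simp add: algebra_simps)
    qed
    then have Fb: "norm (F y t) \<le> (B + L * M) / K * exp (K * \<bar>t\<bar>)" for t
      by (intro norm_antiderivative_exp_bound[of "F y" "g y"] F cy K)
    have "norm (H y t) \<le> norm x0 + (B + L * M) / K" for t
    proof -
      have "norm (H y t) \<le> exp (- K * \<bar>t\<bar>) * (norm x0 + (B + L * M) / K * exp (K * \<bar>t\<bar>))"
        using Fb[of t] norm_triangle_ineq[of x0 "F y t"]
        by (auto simp: H_def intro!: mult_left_mono)
      also have "\<dots> = exp (- K * \<bar>t\<bar>) * norm x0 + (B + L * M) / K"
        by (simp add: algebra_simps exp_minus)
      also have "\<dots> \<le> 1 * norm x0 + (B + L * M) / K"
        using K by (intro add_mono mult_right_mono) auto
      finally show ?thesis by simp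
    qed
    moreover have "continuous_on UNIV (F y)"
      using F(2)[OF cy] by (meson continuous_at_imp_continuous_on has_vector_derivative_continuous)
    then have "continuous_on UNIV (H y)"
      unfolding H_def by (intro continuous_intros)
    ultimately show ?thesis by (auto simp: bcontfun_def bounded_iff)
  qed
  define P where "P y = Bcontfun (H (apply_bcontfun y))" for y :: "real \<Rightarrow>\<^sub>C 'a"
  have P: "apply_bcontfun (P y) = H (apply_bcontfun y)" for y
    unfolding P_def using H apply_bcontfun Bcontfun_inverse by blast
  have "dist (P y) (P z) \<le> 1/2 * dist y z" for y z
  proof (rule dist_bound)
    fix t
    have cy: "continuous_on UNIV (apply_bcontfun y)" "continuous_on UNIV (apply_bcontfun z)" by auto
    have "norm (g y t - g z t) \<le> L * dist y z * exp (K * \<bar>t\<bar>)" for t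
    proof -
      have "norm (g y t - g z t) \<le> L * (exp (K * \<bar>t\<bar>) * norm (y t - z t))"
        using lip[of t "exp (K * \<bar>t\<bar>) *\<^sub>R y t" "exp (K * \<bar>t\<bar>) *\<^sub>R z t"]
        by (simp add: g_def flip: scaleR_diff_right)
      also have "\<dots> \<le> L * (exp (K * \<bar>t\<bar>) * dist y z)"
        using dist_bounded[of y t z] L by (intro mult_left_mono) (auto simp: dist_norm)
      finally show ?thesis by (simp add: algebra_simps)
    qed
    then have *: "norm (F y t - F z t) \<le> L * dist y z / K * exp (K * \<bar>t\<bar>)"
      by (intro norm_antiderivative_exp_bound[of "\<lambda>t. F y t - F z t" "\<lambda>t. g y t - g z t"] K)
        (auto simp: F(1)[OF cy(1)] F(1)[OF cy(2)] intro!: derivative_eq_intros F(2)[OF cy(1)] F(2)[OF cy(2)])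
    have "dist (P y t) (P z t) = exp (- K * \<bar>t\<bar>) * norm (F y t - F z t)"
      by (simp add: P H_def dist_norm flip: scaleR_diff_right)
    also have "\<dots> \<le> exp (- K * \<bar>t\<bar>) * (L * dist y z / K * exp (K * \<bar>t\<bar>))"
      using * by (intro mult_left_mono) auto
    also have "\<dots> = 1/2 * dist y z"
      using L by (simp add: K_def exp_minus)
    finally show "dist (P y t) (P z t) \<le> 1/2 * dist y z" .
  qed
  then have "\<exists>!y. P y = y"
    by (intro banach_fix_type[of "1/2"]) auto
  then obtain y where y: "P y = y" by blast
  have cy: "continuous_on UNIV (apply_bcontfun y)" by auto
  define x where "x t = x0 + F y t" for t
  have "x t = exp (K * \<bar>t\<bar>) *\<^sub>R y t" for t
  proof -
    have "y t = exp (- K * \<bar>t\<bar>) *\<^sub>R x t"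
      using P[of y] y by (metis H_def x_def)
    then show ?thesis by (simp add: exp_minus)
  qed
  then have "g y t = f t (x t)" for t by (simp add: g_def)
  then have "(x has_vector_derivative f t (x t)) (at t)" for t
    using F(2)[OF cy, of t] unfolding x_def by (auto intro!: derivative_eq_intros)
  moreover have "x 0 = x0" using F(1)[OF cy] by (simp add: x_def)
  ultimately show thesis using that by blast
qed

section \<open>Uniqueness by Gronwall estimates\<close>

lemma gronwall_zero_right:
  fixes d :: "real \<Rightarrow> 'a::real_inner"
  assumes d0: "d 0 = 0" and d: "\<And>t. (d has_vector_derivative d' t) (at t)"
    and bound: "\<And>t. t \<in> {0..R} \<Longrightarrow> norm (d' t) \<le> L * norm (d t)" and R: "R \<ge> 0"
  shows "d R = 0"
proof -
  \<comment> \<open>The squared norm is differentiable even where \<open>d\<close> vanishes, and its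
    derivative is at most 2 * L times itself on the interval. The weight turns this into monotone
    decrease from 0.\<close>
  define \<phi> where "\<phi> t = exp (- 2 * L * t) * (d t \<bullet> d t)" for t
  have "\<phi> R \<le> \<phi> 0"
  proof (rule DERIV_nonpos_imp_nonincreasing[OF R])
    fix t assume t: "0 \<le> t" "t \<le> R"
    have "((\<lambda>t. d t \<bullet> d t) has_vector_derivative 2 * (d' t \<bullet> d t)) (at t)"
      using bounded_bilinear.has_vector_derivative[OF bounded_bilinear_inner d d, of t]
      by (simp add: inner_commute)
    then have "(\<phi> has_real_derivative
        - 2 * L * exp (- 2 * L * t) * (d t \<bullet> d t) + exp (- 2 * L * t) * (2 * (d' t \<bullet> d t))) (at t)"
      unfolding \<phi>_def has_real_derivative_iff_has_vector_derivative[symmetric]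
      by (auto intro!: derivative_eq_intros)
    moreover have "d' t \<bullet> d t \<le> L * (d t \<bullet> d t)"
    proof -
      have "d' t \<bullet> d t \<le> norm (d' t) * norm (d t)" by (rule norm_cauchy_schwarz)
      also have "\<dots> \<le> L * norm (d t) * norm (d t)"
        using bound t by (intro mult_right_mono) auto
      finally show ?thesis by (simp add: dot_square_norm power2_eq_square mult.assoc)
    qed
    then have "exp (- 2 * L * t) * (2 * (d' t \<bullet> d t)) \<le> exp (- 2 * L * t) * (2 * (L * (d t \<bullet> d t)))"
      by (intro mult_left_mono) auto
    then have "- 2 * L * exp (- 2 * L * t) * (d t \<bullet> d t) + exp (- 2 * L * t) * (2 * (d' t \<bullet> d t)) \<le> 0"
      by (simp add: algebra_simps)
    ultimately show "\<exists>y. (\<phi> has_real_derivative y) (at t) \<and> y \<le> 0" by blast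
  qed
  then have "\<phi> R \<le> 0" using d0 by (simp add: \<phi>_def)
  then have "d R \<bullet> d R \<le> 0"
    using mult_le_0_iff[of "exp (- 2 * L * R)" "d R \<bullet> d R"] by (auto simp: \<phi>_def not_le[symmetric])
  then show ?thesis by (metis inner_eq_zero_iff inner_ge_zero order_antisym)
qed

text \<open>\<open>L\<close> may depend on the interval, as it must for the Riccati equation, whose
  right-hand side is only locally Lipschitz. Negative times follow by reflection.\<close>

lemma gronwall_zero:
  fixes d :: "real \<Rightarrow> 'a::real_inner"
  assumes d0: "d 0 = 0" and d: "\<And>t. (d has_vector_derivative d' t) (at t)"
    and bound: "\<And>R. \<exists>L. \<forall>t\<in>{-R..R}. norm (d' t) \<le> L * norm (d t)"
  shows "d t = 0"
proof -
  obtain L where L: "\<And>x. x \<in> {-\<bar>t\<bar>..\<bar>t\<bar>} \<Longrightarrow> norm (d' x) \<le> L * norm (d x)"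
    using bound by blast
  show ?thesis
  proof (cases "t \<ge> 0")
    case True
    then show ?thesis using gronwall_zero_right[of d d' t L] d0 d L by auto
  next
    case False
    have "((\<lambda>t. d (- t)) has_vector_derivative - d' (- x)) (at x)" for x
      using has_vector_derivative_affine_arg[of d "d' (- x)" "-1" x 0] d by simp
    then have "d (- (- t)) = 0"
      by (rule gronwall_zero_right[where d="\<lambda>t. d (- t)" and R="- t" and L=L, rotated])
        (use False d0 L in auto)
    then show ?thesis by simp
  qed
qed

subsection \<open>Means of periodic functions\<close>

lemma continuous_periodic_bounded:
  fixes f :: "real \<Rightarrow> 'a::real_normed_vector"
  assumes cont: "continuous_on UNIV f" and per: "\<And>t. f (t + p) = f t" and p: "p > 0"
  obtains M where "\<And>t. norm (f t) \<le> M"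
proof -
  have "bounded (f ` {0..p})"
    by (intro compact_imp_bounded compact_continuous_image continuous_on_subset[OF cont]) auto
  then obtain M where M: "\<And>t. t \<in> {0..p} \<Longrightarrow> norm (f t) \<le> M"
    unfolding bounded_iff by blast
  have pos: "f (t + of_nat n * p) = f t" for t n
    using per by (induction n arbitrary: t) (auto simp: algebra_simps simp flip: add.assoc)
  have "norm (f t) \<le> M" for t
  proof -
    define k where "k = \<lfloor>t / p\<rfloor>"
    have k: "of_int k * p \<le> t" "t \<le> (of_int k + 1) * p"
      using floor_divide_lower[OF p, of t] floor_divide_upper[OF p, of t] by (auto simp: k_def)
    \<comment> \<open>For negative \<open>k\<close> the point is shifted up from \<open>t\<close> by
      \<open>nat (- k)\<close> periods; otherwise \<open>t\<close> itself is reached from its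
      representative in {0..p}.\<close>
    have "f t = f (t - of_int k * p)"
      using pos[of t "nat (- k)"] pos[of "t - of_int k * p" "nat k"] by (cases "k \<ge> 0") auto
    with k M[of "t - of_int k * p"] show ?thesis by (auto simp: algebra_simps)
  qed
  then show thesis using that by blast
qed

lemma integral_antiderivative:
  fixes F :: "real \<Rightarrow> 'a::banach"
  assumes "\<And>t. (F has_vector_derivative f t) (at t)" and "a \<le> b"
  shows "integral {a..b} f = F b - F a"
  using fundamental_theorem_of_calculus[of a b F f] assms
  by (auto intro: integral_unique has_vector_derivative_at_within)

lemma has_vector_derivative_zero_const:
  assumes "\<And>t. (f has_vector_derivative 0) (at (t::real))"
  shows "f t = f u"
  using has_vector_derivative_zero_constant[of UNIV f] assms convex_UNIV
  by (metis UNIV_I)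

text \<open>An antiderivative is linear growth at the mean rate plus a periodic, hence bounded,
  remainder, and the remainder vanishes after division by \<tau>.\<close>

lemma running_average_periodic:
  fixes f :: "real \<Rightarrow> complex"
  assumes cont: "continuous_on UNIV f" and per: "\<And>t. f (t + p) = f t" and p: "p > 0"
  shows "((\<lambda>\<tau>. 1 / complex_of_real \<tau> * integral {0..\<tau>} f)
           \<longlongrightarrow> 1 / complex_of_real p * integral {0..p} f) at_top"
proof -
  obtain F where F: "F 0 = 0" "\<And>t. (F has_vector_derivative f t) (at t)"
    using antiderivative_exists[OF cont] by blast
  have F_integral: "integral {0..\<tau>} f = F \<tau>" if "\<tau> \<ge> 0" for \<tau>
    using integral_antiderivative[of F f 0 \<tau>] F that by simp
  define m where "m = F p / of_real p"
  define E where "E t = F t - of_real t * m" for t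
  have E: "(E has_vector_derivative f t - m) (at t)" for t
    unfolding E_def by (auto intro!: derivative_eq_intros F(2))
  \<comment> \<open>\<open>f - m\<close> is periodic, so the increment over a period is constant;
    the choice of \<open>m\<close> makes it 0 at time 0.\<close>
  have "((\<lambda>t. E (t + p) - E t) has_vector_derivative 0) (at t)" for t
    using has_vector_derivative_affine_arg[of E "f t - m" 1 t p] E[of "t + p"] E[of t]
    by (auto simp: per intro!: derivative_eq_intros)
  then have "E (t + p) - E t = E (0 + p) - E 0" for t
    by (rule has_vector_derivative_zero_const)
  then have "E (t + p) = E t" for t using F(1) p by (simp add: E_def m_def)
  moreover have "continuous_on UNIV E"
    using E by (meson continuous_at_imp_continuous_on has_vector_derivative_continuous)
  ultimately obtain M where M: "\<And>t. norm (E t) \<le> M"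
    using continuous_periodic_bounded[of E p] p by blast
  have "((\<lambda>\<tau>. E \<tau> / of_real \<tau>) \<longlongrightarrow> 0) at_top"
  proof (rule Lim_null_comparison)
    show "\<forall>\<^sub>F \<tau> in at_top. norm (E \<tau> / of_real \<tau>) \<le> M / \<tau>"
      using eventually_gt_at_top[of 0]
      by eventually_elim (use M in \<open>auto simp: norm_divide divide_right_mono\<close>)
    show "((\<lambda>\<tau>. M / \<tau>) \<longlongrightarrow> 0) at_top"
      by (intro tendsto_divide_0[OF tendsto_const] filterlim_at_top_imp_at_infinity filterlim_ident)
  qed
  then have "((\<lambda>\<tau>. E \<tau> / of_real \<tau> + m) \<longlongrightarrow> 0 + m) at_top"
    by (intro tendsto_intros)
  moreover have "\<forall>\<^sub>F \<tau> in at_top. E \<tau> / of_real \<tau> + m = 1 / complex_of_real \<tau> * integral {0..\<tau>} f"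
    using eventually_gt_at_top[of 0]
    by eventually_elim (simp add: E_def F_integral diff_divide_distrib)
  ultimately have "((\<lambda>\<tau>. 1 / complex_of_real \<tau> * integral {0..\<tau>} f) \<longlongrightarrow> 0 + m) at_top"
    by (rule Lim_transform_eventually)
  then show ?thesis using F_integral[of p] p by (simp add: m_def)
qed

lemma continuous_on_if_has_vector_derivative:
  "(\<And>t. (f has_vector_derivative f' t) (at (t::real))) \<Longrightarrow> continuous_on S f"
  by (meson continuous_at_imp_continuous_on has_vector_derivative_continuous)

subsection \<open>The Riccati equation\<close>

lemma riccati_solution_continuous:
  "riccati_solution w s u \<Longrightarrow> continuous_on S u"
  unfolding riccati_solution_def by (rule continuous_on_if_has_vector_derivative) blast

lemma riccati_solution_unique:
  assumes w: "continuous_on UNIV w"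
    and u: "riccati_solution w s u" and v: "riccati_solution w s v" and eq: "u 0 = v 0"
  shows "u = v"
proof
  fix t
  \<comment> \<open>Factoring the difference of squares makes the difference of two solutions
    satisfy a linear equation with coefficient \<open>h\<close>, which is continuous and so bounded
    on compact intervals.\<close>
  define h where "h t = - (\<i> * of_real s + cnj (w t) * (u t + v t))" for t
  have "u t - v t = 0"
  proof (rule gronwall_zero[of "\<lambda>t. u t - v t" "\<lambda>t. h t * (u t - v t)"])
    fix t
    have "h t * (u t - v t) = (w t - \<i> * of_real s * u t - cnj (w t) * (u t)\<^sup>2)
        - (w t - \<i> * of_real s * v t - cnj (w t) * (v t)\<^sup>2)"
      by (simp add: h_def algebra_simps power2_eq_square)
    moreover have "((\<lambda>t. u t - v t) has_vector_derivative
        (w t - \<i> * of_real s * u t - cnj (w t) * (u t)\<^sup>2)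
        - (w t - \<i> * of_real s * v t - cnj (w t) * (v t)\<^sup>2)) (at t)"
      using u v unfolding riccati_solution_def by (blast intro: has_vector_derivative_diff)
    ultimately show "((\<lambda>t. u t - v t) has_vector_derivative h t * (u t - v t)) (at t)"
      by (simp only:)
  next
    fix R
    have "continuous_on {-R..R} h"
      unfolding h_def
      by (intro continuous_intros riccati_solution_continuous[OF u] riccati_solution_continuous[OF v]
          continuous_on_subset[OF w]) auto
    then have "bounded (h ` {-R..R})"
      by (intro compact_imp_bounded compact_continuous_image) auto
    then obtain L where "\<And>t. t \<in> {-R..R} \<Longrightarrow> norm (h t) \<le> L"
      unfolding bounded_iff by blast
    then show "\<exists>L. \<forall>t\<in>{-R..R}. norm (h t * (u t - v t)) \<le> L * norm (u t - v t)"
      by (auto simp: norm_mult intro!: exI[of _ L] mult_right_mono)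
  qed (simp add: eq)
  then show "u t = v t" by simp
qed

lemma riccati_flow_eq:
  assumes "continuous_on UNIV w" "riccati_solution w s u"
  shows "riccati_flow w s (u 0) = u"
  unfolding riccati_flow_def using assms riccati_solution_unique by (intro the_equality) blast+

lemma riccati_solution_shift:
  assumes "riccati_solution w s u" "\<And>t. w (t + p) = w t"
  shows "riccati_solution w s (\<lambda>t. u (t + p))"
  unfolding riccati_solution_def
proof
  fix t
  show "((\<lambda>t. u (t + p)) has_vector_derivative
      w t - \<i> * complex_of_real s * u (t + p) - cnj (w t) * (u (t + p))\<^sup>2) (at t)"
    using has_vector_derivative_affine_arg[of u _ 1 t p]
      assms(1)[unfolded riccati_solution_def, rule_format, of "t + p"] assms(2)
    by fastforce
qed

section \<open>Linearisation in SU(1,1)\<close>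

lemma su11_propagator:
  assumes w: "continuous_on UNIV w" and bound: "\<And>t. cmod (w t) \<le> M"
  obtains P Q where "P 0 = 0" "Q 0 = 1"
    "\<And>t. (P has_vector_derivative w t * Q t - \<i> * of_real (s / 2) * P t) (at t)"
    "\<And>t. (Q has_vector_derivative cnj (w t) * P t + \<i> * of_real (s / 2) * Q t) (at t)"
    "\<And>t. Q t * cnj (Q t) - P t * cnj (P t) = 1"
proof -
  define f where "f t X = (w t * snd X - \<i> * of_real (s / 2) * fst X,
      cnj (w t) * fst X + \<i> * of_real (s / 2) * snd X)" for t and X :: "complex \<times> complex"
  have M: "M \<ge> 0" using order_trans[OF norm_ge_zero bound] .
  \<comment> \<open>Each component contributes at most M + |s|; the extra 1 keeps \<open>L\<close>
    positive when both vanish.\<close>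
  define L where "L = 2 * (M + \<bar>s\<bar>) + 1"
  have f_norm: "norm (f t X) \<le> L * norm X" for t X
  proof -
    have n: "cmod (fst X) \<le> norm X" "cmod (snd X) \<le> norm X"
      by (metis norm_fst_le prod.collapse, metis norm_snd_le prod.collapse)
    have le: "cmod (c * p + \<i> * of_real r * q) \<le> (M + \<bar>s\<bar>) * norm X"
      if "cmod c \<le> M" "\<bar>r\<bar> \<le> \<bar>s\<bar>" "cmod p \<le> norm X" "cmod q \<le> norm X" for c p q r
    proof -
      have "cmod (c * p + \<i> * of_real r * q) \<le> cmod c * cmod p + \<bar>r\<bar> * cmod q"
        by (rule order_trans[OF norm_triangle_ineq]) (simp add: norm_mult)
      also have "\<dots> \<le> M * norm X + \<bar>s\<bar> * norm X"
        using that M by (intro add_mono mult_mono) auto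
      finally show ?thesis by (simp add: algebra_simps)
    qed
    have "norm (f t X) \<le> cmod (fst (f t X)) + cmod (snd (f t X))"
      by (metis norm_Pair_le prod.collapse)
    also have "\<dots> \<le> (M + \<bar>s\<bar>) * norm X + (M + \<bar>s\<bar>) * norm X"
      using le[of "w t" "- (s/2)" "snd X" "fst X"] le[of "cnj (w t)" "s/2" "fst X" "snd X"] n bound[of t]
      by (intro add_mono) (simp_all add: f_def)
    also have "\<dots> \<le> L * norm X" by (simp add: L_def algebra_simps)
    finally show ?thesis .
  qed
  have f_diff: "f t X - f t Y = f t (X - Y)" for t X Y
    by (simp add: f_def right_diff_distrib del: of_real_divide)
  obtain X where X: "X 0 = (0, 1)" "\<And>t. (X has_vector_derivative f t (X t)) (at t)"
  proof (rule lipschitz_ode_global_solution[of f L 0 "(0, 1)"])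
    show "continuous_on UNIV (\<lambda>t. f t (x t))" if "continuous_on UNIV x" for x
      unfolding f_def by (intro continuous_intros w that)
    show "norm (f t X - f t Y) \<le> L * norm (X - Y)" for t X Y
      using f_norm f_diff by metis
    show "norm (f t 0) \<le> 0" for t using f_norm[of t 0] by simp
    show "L > 0" using M by (simp add: L_def)
  qed blast
  define P where "P t = fst (X t)" for t
  define Q where "Q t = snd (X t)" for t
  have P: "(P has_vector_derivative w t * Q t - \<i> * of_real (s / 2) * P t) (at t)" for t
    using bounded_linear.has_vector_derivative[OF bounded_linear_fst X(2)[of t]]
    by (simp add: P_def[abs_def] Q_def f_def)
  have Q: "(Q has_vector_derivative cnj (w t) * P t + \<i> * of_real (s / 2) * Q t) (at t)" for t
    using bounded_linear.has_vector_derivative[OF bounded_linear_snd X(2)[of t]]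
    by (simp add: P_def Q_def[abs_def] f_def)
  \<comment> \<open>This is the determinant of the propagator with columns (cnj Q, cnj P) and (P,
    Q); it is conserved because the system is trace free.\<close>
  have "((\<lambda>t. Q t * cnj (Q t) - P t * cnj (P t)) has_vector_derivative 0) (at t)" for t
    by (rule has_vector_derivative_eq_rhs,
        (rule has_vector_derivative_diff has_vector_derivative_mult has_vector_derivative_cnj P Q)+)
      (simp add: algebra_simps)
  then have "Q t * cnj (Q t) - P t * cnj (P t) = Q 0 * cnj (Q 0) - P 0 * cnj (P 0)" for t
    by (rule has_vector_derivative_zero_const)
  moreover have "P 0 = 0" "Q 0 = 1" by (simp_all add: P_def Q_def X)
  ultimately show thesis using that P Q by simp
qed

lemma su11_norm_less:
  assumes "q * cnj q - p * cnj p = 1"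
  shows "cmod p < cmod q"
proof -
  have "complex_of_real ((cmod q)\<^sup>2 - (cmod p)\<^sup>2) = of_real 1"
    using assms by (simp add: complex_norm_square del: of_real_power)
  then have "(cmod q)\<^sup>2 - (cmod p)\<^sup>2 = 1" by (simp only: of_real_eq_iff)
  then show ?thesis by (intro power2_less_imp_less[OF _ norm_ge_zero]) linarith
qed

text \<open>A zero would give |q| = |c| |p| \<le> |p|, against \<open>su11_norm_less\<close>. So the
  Moebius quotient has no pole for initial values in the closed disc, which makes these Riccati
  solutions global.\<close>

lemma su11_denominator_nonzero:
  assumes "q * cnj q - p * cnj p = 1" "cmod c \<le> 1"
  shows "c * cnj p + q \<noteq> 0"
proof
  assume "c * cnj p + q = 0"
  then have "q = - (c * cnj p)" by (simp add: eq_neg_iff_add_eq_0 add.commute)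
  then have "cmod q = cmod c * cmod p" by (simp add: norm_mult)
  also have "\<dots> \<le> cmod p" using assms(2) by (simp add: mult_left_le_one_le)
  finally show False using su11_norm_less[OF assms(1)] by simp
qed

text \<open>Conjugating the linear system and exchanging its components maps solutions to solutions,
  so (cnj Q, cnj P) is a second one, with value (1, 0) at time 0. The solution from (c, 1) is then
  the combination with coefficients c and 1, and the quotient of its components solves the Riccati
  equation.\<close>

lemma riccati_moebius:
  assumes w: "continuous_on UNIV w" and bound: "\<And>t. cmod (w t) \<le> M"
  obtains P Q where "P 0 = 0" "Q 0 = 1" "\<And>t. Q t * cnj (Q t) - P t * cnj (P t) = 1"
    "\<And>c. cmod c \<le> 1 \<Longrightarrow> riccati_solution w s (riccati_flow w s c)"
    "\<And>c t. cmod c \<le> 1 \<Longrightarrow> riccati_flow w s c t = (c * cnj (Q t) + P t) / (c * cnj (P t) + Q t)"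
proof -
  obtain P Q where PQ0: "P 0 = 0" "Q 0 = 1"
    and P: "\<And>t. (P has_vector_derivative w t * Q t - \<i> * of_real (s / 2) * P t) (at t)"
    and Q: "\<And>t. (Q has_vector_derivative cnj (w t) * P t + \<i> * of_real (s / 2) * Q t) (at t)"
    and det: "\<And>t. Q t * cnj (Q t) - P t * cnj (P t) = 1"
    using su11_propagator[OF w bound] by blast
  define u where "u c t = (c * cnj (Q t) + P t) / (c * cnj (P t) + Q t)" for c t
  have sol: "riccati_solution w s (u c)" if c: "cmod c \<le> 1" for c
    unfolding riccati_solution_def
  proof
    fix t
    define n where "n t = c * cnj (Q t) + P t" for t
    define d where "d t = c * cnj (P t) + Q t" for t
    have d0: "d t \<noteq> 0" unfolding d_def by (rule su11_denominator_nonzero[OF det c])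
    have n: "(n has_vector_derivative w t * d t - \<i> * of_real (s / 2) * n t) (at t)"
      unfolding n_def
      by (rule has_vector_derivative_eq_rhs, (rule derivative_intros has_vector_derivative_cnj P Q)+)
        (simp add: d_def algebra_simps)
    have d: "(d has_vector_derivative cnj (w t) * n t + \<i> * of_real (s / 2) * d t) (at t)"
      unfolding d_def
      by (rule has_vector_derivative_eq_rhs, (rule derivative_intros has_vector_derivative_cnj P Q)+)
        (simp add: n_def algebra_simps)
    have inv: "((\<lambda>t. inverse (d t)) has_vector_derivative
        (cnj (w t) * n t + \<i> * of_real (s / 2) * d t) * (- (inverse (d t))\<^sup>2)) (at t)"
      using field_vector_diff_chain_at[OF d, of inverse "- (inverse (d t))\<^sup>2"] DERIV_inverse[OF d0]
      by (simp add: o_def numeral_2_eq_2)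
    have "((\<lambda>t. n t * inverse (d t)) has_vector_derivative
        w t - \<i> * of_real s * (n t * inverse (d t)) - cnj (w t) * (n t * inverse (d t))\<^sup>2) (at t)"
      by (rule has_vector_derivative_eq_rhs, rule has_vector_derivative_mult[OF n inv])
        (use d0 in \<open>simp add: field_simps power2_eq_square\<close>)
    then show "(u c has_vector_derivative
        w t - \<i> * of_real s * u c t - cnj (w t) * (u c t)\<^sup>2) (at t)"
      by (simp add: u_def[abs_def] n_def d_def divide_inverse)
  qed
  have "riccati_flow w s c = u c" if "cmod c \<le> 1" for c
    using riccati_flow_eq[OF w sol[OF that]] PQ0 by (simp add: u_def)
  with sol show thesis using PQ0 det by (intro that[of P Q]) (simp_all add: u_def)
qed

section \<open>Solutions on the unit circle\<close>

lemma has_vector_derivative_cis: "(cis has_vector_derivative \<i> * cis t) (at t)"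
proof -
  have "exp (r *\<^sub>R \<i>) = cis r" for r
    by (simp add: cis_conv_exp scaleR_conv_of_real mult.commute)
  with exp_scaleR_has_vector_derivative_right[of \<i> t UNIV] show ?thesis
    by (simp add: mult.commute)
qed

lemma norm_cis_diff_le: "cmod (cis x - cis y) \<le> \<bar>x - y\<bar>"
proof -
  have "cmod (cis b - cis a) \<le> b - a" if "a < b" for a b
  proof (rule differentiable_bound_general[where f' = "\<lambda>t. \<i> * cis t" and \<phi>' = "\<lambda>_. 1"])
    show "(cis has_vector_derivative \<i> * cis t) (at t)" for t
      by (rule has_vector_derivative_cis)
  qed (use that in \<open>auto intro!: continuous_intros derivative_eq_intros simp: norm_mult\<close>)
  from this[of x y] this[of y x] show ?thesis
    by (cases x y rule: linorder_cases) (auto simp: norm_minus_commute)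
qed

text \<open>Existence and uniqueness together make the \<open>THE\<close> in
  \<open>phase_flow\<close> meaningful. The phase enters only through \<open>cis\<close>, which is
  1-Lipschitz, so the right-hand side is globally Lipschitz.\<close>

lemma phase_flow_solution:
  assumes w: "continuous_on UNIV w" and bound: "\<And>t. cmod (w t) \<le> M"
  shows "phase_flow w s 0 = 0"
    "(phase_flow w s has_real_derivative
        - s + 2 * Im (w t * exp (- \<i> * complex_of_real (phase_flow w s t)))) (at t)"
proof -
  define f where "f t \<psi> = - s + 2 * Im (w t * exp (- \<i> * complex_of_real \<psi>))" for t \<psi>
  have M: "M \<ge> 0" using order_trans[OF norm_ge_zero bound] .
  define L where "L = 2 * M + 1"
  have lip: "\<bar>f t x - f t y\<bar> \<le> L * \<bar>x - y\<bar>" for t x y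
  proof -
    have "f t x - f t y = 2 * Im (w t * (cis (- x) - cis (- y)))"
      by (simp add: f_def cis_conv_exp algebra_simps)
    also have "\<bar>\<dots>\<bar> \<le> 2 * cmod (w t * (cis (- x) - cis (- y)))"
      using abs_Im_le_cmod[of "w t * (cis (- x) - cis (- y))"] by (simp only: abs_mult)
    also have "\<dots> \<le> 2 * (M * \<bar>x - y\<bar>)"
      using bound[of t] norm_cis_diff_le[of "- x" "- y"] M
      by (auto simp: norm_mult abs_minus_commute intro!: mult_mono)
    also have "\<dots> \<le> L * \<bar>x - y\<bar>" by (simp add: L_def algebra_simps)
    finally show ?thesis .
  qed
  obtain \<Psi> where \<Psi>: "\<Psi> 0 = 0" "\<And>t. (\<Psi> has_vector_derivative f t (\<Psi> t)) (at t)"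
  proof (rule lipschitz_ode_global_solution[of f L "\<bar>s\<bar> + 2 * M" 0])
    show "continuous_on UNIV (\<lambda>t. f t (x t))" if "continuous_on UNIV x" for x
      unfolding f_def by (intro continuous_intros w that)
    show "norm (f t x - f t y) \<le> L * norm (x - y)" for t x y
      using lip by simp
    show "norm (f t 0) \<le> \<bar>s\<bar> + 2 * M" for t
      using bound[of t] abs_Im_le_cmod[of "w t"] unfolding f_def real_norm_def by simp
    show "L > 0" using M by (simp add: L_def)
  qed blast
  have unique: "\<Phi> = \<Psi>" if "\<Phi> 0 = 0" "\<And>t. (\<Phi> has_real_derivative f t (\<Phi> t)) (at t)" for \<Phi>
  proof
    fix t
    have "\<Phi> t - \<Psi> t = 0"
    proof (rule gronwall_zero[of "\<lambda>t. \<Phi> t - \<Psi> t" "\<lambda>t. f t (\<Phi> t) - f t (\<Psi> t)"])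
      show "((\<lambda>t. \<Phi> t - \<Psi> t) has_vector_derivative f t (\<Phi> t) - f t (\<Psi> t)) (at t)" for t
        using that(2)[of t] \<Psi>(2)[of t] unfolding has_real_derivative_iff_has_vector_derivative
        by (rule has_vector_derivative_diff)
      show "\<exists>L. \<forall>t\<in>{-R..R}. norm (f t (\<Phi> t) - f t (\<Psi> t)) \<le> L * norm (\<Phi> t - \<Psi> t)" for R
        using lip by (intro exI[of _ L]) simp
    qed (simp add: that \<Psi>)
    then show "\<Phi> t = \<Psi> t" by simp
  qed
  have \<Psi>': "(\<Psi> has_real_derivative f t (\<Psi> t)) (at t)" for t
    unfolding has_real_derivative_iff_has_vector_derivative by (rule \<Psi>(2))
  have "phase_flow w s = \<Psi>"
    unfolding phase_flow_def f_def[symmetric]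
    by (rule the_equality) (use \<Psi>(1) \<Psi>' unique in blast)+
  then show "phase_flow w s 0 = 0"
    "(phase_flow w s has_real_derivative
        - s + 2 * Im (w t * exp (- \<i> * complex_of_real (phase_flow w s t)))) (at t)"
    using \<Psi>(1) \<Psi>'[of t] by (simp_all only: f_def)
qed

text \<open>On the unit circle the inverse of e is cnj e, so w - cnj w * e^2 is e times the
  imaginary number 2 * i * Im (w * cnj e): the Riccati field is tangent to the circle, and the angle
  obeys the phase equation.\<close>

lemma cis_phase_flow:
  assumes w: "continuous_on UNIV w" and bound: "\<And>t. cmod (w t) \<le> M"
  shows "riccati_flow w s 1 t = cis (phase_flow w s t)"
proof -
  define \<Psi> where "\<Psi> = phase_flow w s"
  have "riccati_solution w s (\<lambda>t. cis (\<Psi> t))"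
    unfolding riccati_solution_def
  proof
    fix t
    define e where "e = cis (\<Psi> t)"
    have e: "e * cnj e = 1" by (simp add: e_def cis_mult cis_cnj)
    have im: "2 * \<i> * of_real (Im x) = x - cnj x" for x by (simp add: complex_eq_iff)
    have "exp (- \<i> * complex_of_real (\<Psi> t)) = cnj e"
      unfolding e_def cis_cnj by (simp add: cis_conv_exp)
    then have "(\<Psi> has_vector_derivative - s + 2 * Im (w t * cnj e)) (at t)"
      using phase_flow_solution(2)[OF w bound, of s t]
      by (simp add: \<Psi>_def has_real_derivative_iff_has_vector_derivative)
    moreover have "(cis has_vector_derivative \<i> * e) (at (\<Psi> t))"
      unfolding e_def by (rule has_vector_derivative_cis)
    ultimately have "((\<lambda>t. cis (\<Psi> t)) has_vector_derivative
        (- s + 2 * Im (w t * cnj e)) *\<^sub>R (\<i> * e)) (at t)"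
      using vector_diff_chain_at[of \<Psi> "- s + 2 * Im (w t * cnj e)" t cis "\<i> * e"]
      by (simp add: o_def)
    moreover have "(- s + 2 * Im (w t * cnj e)) *\<^sub>R (\<i> * e)
        = w t - \<i> * of_real s * e - cnj (w t) * e\<^sup>2"
    proof -
      have "(- s + 2 * Im (w t * cnj e)) *\<^sub>R (\<i> * e)
          = - \<i> * of_real s * e + (2 * \<i> * of_real (Im (w t * cnj e))) * e"
        by (simp add: scaleR_conv_of_real algebra_simps)
      also have "\<dots> = - \<i> * of_real s * e + (w t * cnj e - cnj (w t) * e) * e"
        by (simp only: im) simp
      also have "\<dots> = w t * (e * cnj e) - \<i> * of_real s * e - cnj (w t) * e\<^sup>2"
        by (simp add: algebra_simps power2_eq_square)
      finally show ?thesis by (simp add: e)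
    qed
    ultimately show "((\<lambda>t. cis (\<Psi> t)) has_vector_derivative
        w t - \<i> * of_real s * cis (\<Psi> t) - cnj (w t) * (cis (\<Psi> t))\<^sup>2) (at t)"
      by (simp add: e_def)
  qed
  from riccati_flow_eq[OF w this] show ?thesis
    using phase_flow_solution(1)[OF w bound] by (simp add: \<Psi>_def)
qed

subsection \<open>The fixed point of the Poincare map\<close>

text \<open>\<open>k\<close> is the bracket in the formula for \<open>fixed_pt\<close>. Writing the
  point as k * cis (\<theta> / 2) / cnj b turns the fixed point equation into this quadratic. Its
  roots have product - |b|^2, and the definition selects one of least modulus, whence the
  bound.\<close>

lemma fixed_pt_root:
  assumes "b \<noteq> 0"
  obtains k where
    "fixed_pt b \<theta> = k * (b * cis (\<theta> / 2) / complex_of_real ((cmod b)\<^sup>2))"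
    "k\<^sup>2 = 2 * \<i> * of_real (sin (\<theta> / 2)) * k + of_real ((cmod b)\<^sup>2)"
    "cmod k \<le> cmod b"
proof -
  define \<sigma> where "\<sigma> = sin (\<theta> / 2)"
  define r where "r = cmod b"
  have r: "r \<ge> 0" by (simp add: r_def)
  define k where "k = (if r > \<bar>\<sigma>\<bar> then \<i> * complex_of_real \<sigma> + complex_of_real (sqrt (r\<^sup>2 - \<sigma>\<^sup>2))
     else if r \<le> \<sigma> then \<i> * complex_of_real \<sigma> - \<i> * complex_of_real (sqrt (\<sigma>\<^sup>2 - r\<^sup>2))
     else \<i> * complex_of_real \<sigma> + \<i> * complex_of_real (sqrt (\<sigma>\<^sup>2 - r\<^sup>2)))"
  have "fixed_pt b \<theta> = k * (b * cis (\<theta> / 2) / complex_of_real (r\<^sup>2))"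
    using assms by (simp add: fixed_pt_def Let_def k_def \<sigma>_def r_def cis_conv_exp)
  moreover have "k\<^sup>2 = 2 * \<i> * of_real \<sigma> * k + of_real (r\<^sup>2) \<and> cmod k \<le> r"
  proof (cases "r > \<bar>\<sigma>\<bar>")
    case True
    then have "\<sigma>\<^sup>2 \<le> r\<^sup>2" using abs_le_square_iff[of \<sigma> r] by simp
    then have q: "(sqrt (r\<^sup>2 - \<sigma>\<^sup>2))\<^sup>2 = r\<^sup>2 - \<sigma>\<^sup>2" by simp
    define q' where "q' = sqrt (r\<^sup>2 - \<sigma>\<^sup>2)"
    \<comment> \<open>The squares of the two parts add up to that of \<open>r\<close>, so the
      modulus is exactly \<open>r\<close>.\<close>
    have "k = Complex q' \<sigma>" using True by (simp add: k_def complex_eq_iff q'_def)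
    with q show ?thesis unfolding q'_def[symmetric] using r
      by (simp add: complex_eq_iff cmod_def) (simp add: power2_eq_square algebra_simps)
  next
    case False
    then have "r\<^sup>2 \<le> \<sigma>\<^sup>2" using abs_le_square_iff[of r \<sigma>] r by simp
    define q where "q = sqrt (\<sigma>\<^sup>2 - r\<^sup>2)"
    have q: "q\<^sup>2 = \<sigma>\<^sup>2 - r\<^sup>2" "q \<ge> 0" using \<open>r\<^sup>2 \<le> \<sigma>\<^sup>2\<close> by (simp_all add: q_def)
    have "q \<le> \<bar>\<sigma>\<bar>" using q abs_le_square_iff[of q \<sigma>] r by simp
    \<comment> \<open>The square of \<open>q\<close> is (|\<sigma>| - r) * (|\<sigma>| + r), which
      is at least the square of the first factor.\<close>
    have "(\<bar>\<sigma>\<bar> - r)\<^sup>2 \<le> q\<^sup>2"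
    proof -
      have "(\<bar>\<sigma>\<bar> - r) * (\<bar>\<sigma>\<bar> - r) \<le> (\<bar>\<sigma>\<bar> - r) * (\<bar>\<sigma>\<bar> + r)"
        using False r by (intro mult_left_mono) auto
      then show ?thesis using q by (simp add: power2_eq_square algebra_simps)
    qed
    then have *: "\<bar>\<sigma>\<bar> - r \<le> q" using q(2) by (rule power2_le_imp_le)
    \<comment> \<open>Failing both tests forces \<sigma> to be negative, so in either case the
      modulus of \<open>k'\<close> is |\<sigma>| - q, at most \<open>r\<close> by the last
      estimate.\<close>
    define k' where "k' = (if r \<le> \<sigma> then \<sigma> - q else \<sigma> + q)"
    have "k = \<i> * of_real k'" using False by (simp add: k_def k'_def q_def algebra_simps)
    moreover from this have "cmod k = \<bar>k'\<bar>" by (simp add: norm_mult)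
    moreover have "\<bar>k'\<bar> \<le> r" using False * \<open>q \<le> \<bar>\<sigma>\<bar>\<close> r by (auto simp: k'_def abs_if split: if_splits)
    moreover have "k' * k' = 2 * \<sigma> * k' - r\<^sup>2"
      using q(1) by (auto simp: k'_def power2_eq_square algebra_simps)
    ultimately show ?thesis
      by (simp add: complex_eq_iff power2_eq_square)
  qed
  ultimately show thesis using that[of k] unfolding \<sigma>_def r_def by blast
qed

lemma norm_fixed_pt_le: "cmod (fixed_pt b \<theta>) \<le> 1"
proof (cases "b = 0")
  case False
  then obtain k where k: "fixed_pt b \<theta> = k * (b * cis (\<theta> / 2) / complex_of_real ((cmod b)\<^sup>2))"
    "cmod k \<le> cmod b" using fixed_pt_root by metis
  have "cmod (fixed_pt b \<theta>) = cmod k / cmod b"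
    using False by (simp add: k(1) norm_mult norm_divide norm_power power2_eq_square)
  also have "\<dots> \<le> 1" using k(2) False by simp
  finally show ?thesis .
qed (simp add: fixed_pt_def)

text \<open>With u = \<open>fixed_pt b \<theta>\<close> and E = cis (\<theta> / 2), cnj b * u = k *
  E, and the claim becomes the quadratic of \<open>fixed_pt_root\<close>. For b = 0 both sides
  vanish.\<close>

lemma fixed_pt_equation:
  "cis \<theta> * (fixed_pt b \<theta> + b) = (cnj b * fixed_pt b \<theta> + 1) * fixed_pt b \<theta>"
proof (cases "b = 0")
  case False
  define \<sigma> where "\<sigma> = sin (\<theta> / 2)"
  define E where "E = cis (\<theta> / 2)"
  define u where "u = fixed_pt b \<theta>"
  obtain k where u: "u = k * (b * E / (b * cnj b))"
    and k: "k\<^sup>2 = 2 * \<i> * of_real \<sigma> * k + b * cnj b"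
    using fixed_pt_root[OF False, of \<theta>] unfolding complex_norm_square u_def E_def \<sigma>_def by metis
  \<comment> \<open>This converts the sine in the quadratic into powers of \<open>E\<close>, whose
    square is cis \<theta>.\<close>
  have "2 * \<i> * of_real \<sigma> = E - cnj E"
    by (simp add: E_def \<sigma>_def complex_eq_iff)
  then have \<sigma>: "2 * \<i> * of_real \<sigma> * E = E\<^sup>2 - 1"
    by (simp add: left_diff_distrib power2_eq_square) (simp add: E_def cis_cnj cis_mult)
  have u': "cnj b * u = k * E" using False by (simp add: u)
  have bb: "b * cnj b = k\<^sup>2 - 2 * \<i> * of_real \<sigma> * k" by (simp add: k)
  \<comment> \<open>Both sides are multiplied by cnj b so that \<open>u\<close> can be replaced
    through \<open>k * E\<close>; the factor is cancelled at the end.\<close>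
  have "cnj b * (E\<^sup>2 * (u + b)) = E\<^sup>2 * (k * E) + E\<^sup>2 * (b * cnj b)"
    using u' by (simp add: algebra_simps)
  also have "\<dots> = E\<^sup>2 * (k * E) + E\<^sup>2 * k\<^sup>2 - (2 * \<i> * of_real \<sigma> * E) * k * E"
    unfolding bb by (simp add: algebra_simps power2_eq_square)
  also have "\<dots> = (k * E + 1) * (k * E)"
    by (simp add: \<sigma>) (simp add: algebra_simps power2_eq_square)
  also have "\<dots> = cnj b * ((cnj b * u + 1) * u)"
    by (simp add: u'[symmetric])
  finally have "E\<^sup>2 * (u + b) = (cnj b * u + 1) * u" using False by simp
  moreover have "E\<^sup>2 = cis \<theta>" by (simp add: E_def power2_eq_square cis_mult)
  ultimately show ?thesis by (simp add: u_def)
qed (simp add: fixed_pt_def)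

text \<open>In terms of the propagator the period map sends c to (c * cnj q + p) / (c * cnj p + q).
  Comparison with the normal form gives b = p / cnj q and cis \<theta> = cnj q / q, so
  \<open>fixed_pt\<close> yields an initial value that returns to itself, and uniqueness propagates
  this to all times.\<close>

lemma sol_op_periodic_solution:
  assumes w: "continuous_on UNIV w" and per: "\<And>t. w (t + 2 * pi) = w t"
  shows "riccati_solution w s (sol_op w s)" "sol_op w s (t + 2 * pi) = sol_op w s t"
proof -
  obtain M where bound: "\<And>t. cmod (w t) \<le> M"
    using continuous_periodic_bounded[OF w per] by auto
  obtain P Q where PQ0: "P 0 = 0" "Q 0 = 1"
    and det: "\<And>t. Q t * cnj (Q t) - P t * cnj (P t) = 1"
    and sol: "\<And>c. cmod c \<le> 1 \<Longrightarrow> riccati_solution w s (riccati_flow w s c)"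
    and flow: "\<And>c t. cmod c \<le> 1 \<Longrightarrow>
      riccati_flow w s c t = (c * cnj (Q t) + P t) / (c * cnj (P t) + Q t)"
    using riccati_moebius[OF w bound] by metis
  have flow0: "riccati_flow w s c 0 = c" if "cmod c \<le> 1" for c
    using flow[OF that] PQ0 by simp
  define p where "p = P (2 * pi)"
  define q where "q = Q (2 * pi)"
  have det1: "q * cnj q - p * cnj p = 1" by (simp add: p_def q_def det)
  have q: "q \<noteq> 0" using su11_denominator_nonzero[OF det1, of 0] by simp
  define b where "b = poincare_b w s"
  define \<theta> where "\<theta> = poincare_theta w s"
  \<comment> \<open>The solution through 0 at time 0, moved one period later, starts at \<zeta> and
    reaches 0 after one period, so \<zeta> is the zero of the numerator.\<close>
  have b: "b = p / cnj q"
  proof -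
    define \<zeta> where "\<zeta> = riccati_flow w s 0 (- 2 * pi)"
    have \<zeta>_PQ: "\<zeta> = P (- 2 * pi) / Q (- 2 * pi)" using flow[of 0] by (simp add: \<zeta>_def)
    have "cmod \<zeta> \<le> 1"
      using su11_norm_less[OF det, of "- 2 * pi"] by (simp add: \<zeta>_PQ norm_divide divide_le_eq_1)
    have per': "w (t + - 2 * pi) = w t" for t using per[of "t - 2 * pi"] by simp
    have "riccati_solution w s (\<lambda>t. riccati_flow w s 0 (t + - 2 * pi))"
      by (rule riccati_solution_shift[OF sol per']) simp
    from riccati_flow_eq[OF w this]
    have "riccati_flow w s \<zeta> = (\<lambda>t. riccati_flow w s 0 (t + - 2 * pi))"
      by (simp add: \<zeta>_def)
    then have "riccati_flow w s \<zeta> (2 * pi) = riccati_flow w s 0 (2 * pi + - 2 * pi)"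
      by (rule fun_cong)
    also have "\<dots> = 0" using flow0[of 0] by simp
    finally have "(\<zeta> * cnj q + p) / (\<zeta> * cnj p + q) = 0"
      using flow[OF \<open>cmod \<zeta> \<le> 1\<close>, of "2 * pi"] by (simp add: p_def q_def)
    then have "\<zeta> * cnj q + p = 0"
      using su11_denominator_nonzero[OF det1 \<open>cmod \<zeta> \<le> 1\<close>] by simp
    then have "\<zeta> = - p / cnj q" using q by (simp add: field_simps eq_neg_iff_add_eq_0)
    then show ?thesis by (simp add: b_def poincare_b_def \<zeta>_def)
  qed
  have \<theta>: "cis \<theta> = cnj q / q"
  proof -
    have ne: "cnj q + p \<noteq> 0" "q + cnj p \<noteq> 0"
      using su11_denominator_nonzero[OF det1, of 1]
      by (metis add.commute complex_cnj_add complex_cnj_cnj complex_cnj_zero_iff mult_1 norm_one order_refl)+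
    have "exp (\<i> * complex_of_real (phase_flow w s (2 * pi))) = (cnj q + p) / (cnj p + q)"
      using cis_phase_flow[OF w bound, of s "2 * pi"] flow[of 1 "2 * pi"]
      by (simp add: cis_conv_exp p_def q_def)
    moreover have "riccati_flow w s 0 (- 2 * pi) = - p / cnj q"
      using b by (simp add: b_def poincare_b_def minus_equation_iff)
    ultimately have "\<theta> = Arg ((cnj (- p / cnj q) - 1) / (- p / cnj q - 1) * ((cnj q + p) / (cnj p + q)))"
      unfolding \<theta>_def poincare_theta_def Let_def by (simp only:)
    also have "(cnj (- p / cnj q) - 1) / (- p / cnj q - 1) * ((cnj q + p) / (cnj p + q)) = cnj q / q"
    proof -
      \<comment> \<open>The quotient in \<zeta> is A / B times cnj q / q, and the image of 1 is B /
        A.\<close>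
      define A B where "A = cnj p + q" and "B = cnj q + p"
      have "A \<noteq> 0" "B \<noteq> 0" using ne by (simp_all add: A_def B_def add.commute)
      moreover have "cnj (- p / cnj q) - 1 = - A / q" "- p / cnj q - 1 = - B / cnj q"
        using q by (simp_all add: A_def B_def field_simps)
      ultimately show ?thesis unfolding A_def[symmetric] B_def[symmetric] using q by simp
    qed
    \<comment> \<open>The modulus of cnj q / q is 1, so \<open>sgn\<close> leaves it
      unchanged.\<close>
    finally have "cis \<theta> = sgn (cnj q / q)" using q by (simp add: cis_Arg)
    then show ?thesis using q by (simp add: sgn_eq norm_divide)
  qed
  define c where "c = fixed_pt b \<theta>"
  have c1: "cmod c \<le> 1" by (simp add: c_def norm_fixed_pt_le)
  have sol_op: "sol_op w s = riccati_flow w s c" by (simp add: sol_op_def c_def b_def \<theta>_def)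
  show sol_c: "riccati_solution w s (sol_op w s)" using sol c1 by (simp add: sol_op)
  have "riccati_flow w s c (2 * pi) = c"
  proof -
    have "cnj q / q * (c + p / cnj q) = (cnj p / q * c + 1) * c"
      using fixed_pt_equation[of \<theta> b] b \<theta> by (simp add: c_def)
    then have "q * (cnj q / q * (c + p / cnj q)) = q * ((cnj p / q * c + 1) * c)" by simp
    moreover have "q * (cnj q / q * (c + p / cnj q)) = c * cnj q + p"
      using q by (simp add: algebra_simps)
    moreover have "q * ((cnj p / q * c + 1) * c) = (c * cnj p + q) * c"
      using q by (simp add: algebra_simps)
    ultimately have "c * cnj q + p = (c * cnj p + q) * c" by simp
    then show ?thesis
      using flow[OF c1, of "2 * pi"] su11_denominator_nonzero[OF det1 c1] by (simp add: p_def q_def)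
  qed
  \<comment> \<open>The solution shifted by a period has the value \<open>c\<close> at time 0, hence
    it is the same solution.\<close>
  moreover have "riccati_solution w s (\<lambda>t. sol_op w s (t + 2 * pi))"
    by (rule riccati_solution_shift[OF sol_c per])
  from riccati_flow_eq[OF w this]
  have "riccati_flow w s (sol_op w s (2 * pi)) = (\<lambda>t. sol_op w s (t + 2 * pi))" by simp
  ultimately have "riccati_flow w s c = (\<lambda>t. sol_op w s (t + 2 * pi))"
    by (simp add: sol_op)
  then show "sol_op w s (t + 2 * pi) = sol_op w s t" by (metis sol_op)
qed

subsection \<open>Time averages\<close>

lemma coupling_op_mult_right: "coupling_op G (\<lambda>y. u y * c) x = coupling_op G u x * c"
  by (simp add: coupling_op_def flip: mult.assoc)

text \<open>\<open>G\<close> is real valued, so conjugation passes through the kernel.\<close>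

lemma coupling_op_cnj: "coupling_op G (\<lambda>y. cnj (u y)) x = cnj (coupling_op G u x)"
  by (simp add: coupling_op_def integral_cnj)

lemma integral_scaled_period:
  fixes f :: "real \<Rightarrow> complex"
  assumes cont: "continuous_on UNIV f" and "\<omega> > 0" "p \<ge> 0"
  shows "integral {0..p / \<omega>} (\<lambda>t. f (\<omega> * t)) = integral {0..p} f / of_real \<omega>"
proof -
  obtain F where F: "\<And>t. (F has_vector_derivative f t) (at t)"
    using antiderivative_exists[OF cont] by blast
  have "((\<lambda>t. F (\<omega> * t)) has_vector_derivative \<omega> *\<^sub>R f (\<omega> * t)) (at t)" for t
    using has_vector_derivative_affine_arg[of F "f (\<omega> * t)" \<omega> t 0] F by simp
  then have "((\<lambda>t. F (\<omega> * t) / of_real \<omega>) has_vector_derivative f (\<omega> * t)) (at t)" for t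
    using \<open>\<omega> > 0\<close> has_vector_derivative_divide[of "\<lambda>t. F (\<omega> * t)" "\<omega> *\<^sub>R f (\<omega> * t)" "at t" "of_real \<omega>"]
    by (simp add: scaleR_conv_of_real)
  then have "integral {0..p / \<omega>} (\<lambda>t. f (\<omega> * t)) = F p / of_real \<omega> - F 0 / of_real \<omega>"
    using integral_antiderivative[of "\<lambda>t. F (\<omega> * t) / of_real \<omega>" "\<lambda>t. f (\<omega> * t)" 0 "p / \<omega>"] assms
    by simp
  also have "\<dots> = integral {0..p} f / of_real \<omega>"
    using integral_antiderivative[OF F] assms by (simp add: diff_divide_distrib)
  finally show ?thesis .
qed

theorem proposition3p1:
  fixes G :: "real \<Rightarrow> real" and w u a z :: "real \<Rightarrow> real \<Rightarrow> complex"
    and \<alpha> \<omega> s T \<Omega> :: real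
  assumes kernel: "coupling_kernel G"
    and alpha: "- pi / 2 < \<alpha>" "\<alpha> < pi / 2"
    and w: "w \<in> C_per2"
    and omega: "\<omega> > 0"
    and self_consistency:
      "\<forall>x t. 2 * complex_of_real \<omega> * exp (\<i> * complex_of_real \<alpha>) * w x t
              - coupling_op G (\<lambda>y. sol_op (w y) s t) x = 0"
    and u: "\<forall>x t. u x t = sol_op (w x) s t"
    and a: "\<forall>x t. a x t = u x (\<omega> * t)"
    and T: "T = 2 * pi / \<omega>"
    and Omega: "\<Omega> = s * \<omega>"
    and z: "\<forall>x t. z x t = a x t * exp (\<i> * complex_of_real (\<Omega> * t))"
  shows "(\<forall>t. cmod (order_parameter z t) = 1 / (2 * pi) * cmod (integral {-pi..pi} (\<lambda>x. a x t))
            \<and> 1 / (2 * pi) * cmod (integral {-pi..pi} (\<lambda>x. a x t))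
              = 1 / (2 * pi) * cmod (integral {-pi..pi} (\<lambda>x. u x (\<omega> * t))))
       \<and> (\<forall>x. (\<exists>L. (running_average G z x \<longlongrightarrow> L) at_top)
            \<and> effective_frequency G \<alpha> z x
              = - Im (1 / complex_of_real T * integral {0..T} (\<lambda>t.
                    exp (\<i> * complex_of_real \<alpha>) * a x t * coupling_op G (\<lambda>y. cnj (a y t)) x))
            \<and> - Im (1 / complex_of_real T * integral {0..T} (\<lambda>t.
                    exp (\<i> * complex_of_real \<alpha>) * a x t * coupling_op G (\<lambda>y. cnj (a y t)) x))
              = - 2 * \<omega> * Im (1 / (2 * complex_of_real pi)
                    * integral {0..2 * pi} (\<lambda>t. u x t * cnj (w x t))))"
proof (intro conjI allI)
  fix t
  \<comment> \<open>The phase factor is independent of x and nonzero. It leaves the integral for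
    every integrand: if one side is not integrable, neither is the other, and both integrals are
    0.\<close>
  have "integral {-pi..pi} (\<lambda>x. z x t)
      = integral {-pi..pi} (\<lambda>x. a x t) * exp (\<i> * complex_of_real (\<Omega> * t))"
    by (simp add: z)
  then show "cmod (order_parameter z t) = 1 / (2 * pi) * cmod (integral {-pi..pi} (\<lambda>x. a x t))"
    by (simp add: order_parameter_def norm_mult norm_divide)
  show "1 / (2 * pi) * cmod (integral {-pi..pi} (\<lambda>x. a x t))
      = 1 / (2 * pi) * cmod (integral {-pi..pi} (\<lambda>x. u x (\<omega> * t)))"
    by (simp add: a)
next
  fix x
  define E where "E = exp (\<i> * complex_of_real \<alpha>)"
  define h where "h t = u x t * cnj (w x t)" for t
  define g where "g t = a x t * coupling_op G (\<lambda>y. cnj (a y t)) x" for t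
  have T_pos: "T > 0" using T omega by simp
  have E: "E * cnj E = 1" by (simp add: E_def exp_cnj flip: exp_add)
  have "continuous_on UNIV ((\<lambda>(x, t). w x t) \<circ> Pair x)"
    using w unfolding C_per2_def
    by (intro continuous_on_compose continuous_intros) (auto intro: continuous_on_subset)
  then have w_cont: "continuous_on UNIV (w x)" by (simp add: o_def)
  have w_per: "w x (t + 2 * pi) = w x t" for t
    using w by (simp add: C_per2_def)
  have u_x: "u x = sol_op (w x) s" using u by auto
  have h_cont: "continuous_on UNIV h"
    unfolding h_def u_x
    by (intro continuous_intros w_cont
        riccati_solution_continuous[OF sol_op_periodic_solution(1)[OF w_cont w_per]])
  have h_per: "h (t + 2 * pi) = h t" for t
    by (simp add: h_def u_x w_per sol_op_periodic_solution(2)[OF w_cont w_per])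
  \<comment> \<open>The conjugated self-consistency equation at time \<omega> * t replaces the
    coupling integral by a multiple of cnj w.\<close>
  have g_h: "g t = 2 * of_real \<omega> * cnj E * h (\<omega> * t)" for t
  proof -
    have "coupling_op G (\<lambda>y. cnj (a y t)) x = cnj (coupling_op G (\<lambda>y. sol_op (w y) s (\<omega> * t)) x)"
      by (simp add: coupling_op_cnj a u)
    also have "\<dots> = cnj (2 * of_real \<omega> * E * w x (\<omega> * t))"
      using self_consistency by (simp add: E_def)
    finally show ?thesis by (simp add: g_def h_def a)
  qed
  \<comment> \<open>The phase is common to all \<open>y\<close>, so it leaves the coupling integral
    and cancels against its conjugate.\<close>
  have g_z: "z x t * coupling_op G (\<lambda>y. cnj (z y t)) x = g t" for t
  proof -
    define e where "e = exp (\<i> * complex_of_real (\<Omega> * t))"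
    have "e * cnj e = 1" by (simp add: e_def exp_cnj flip: exp_add)
    have "z y t = a y t * e" for y by (simp add: z e_def)
    then have "z x t * coupling_op G (\<lambda>y. cnj (z y t)) x = (e * cnj e) * g t"
      by (simp add: coupling_op_mult_right g_def)
    then show ?thesis using \<open>e * cnj e = 1\<close> by simp
  qed
  \<comment> \<open>Continuity in time comes from the form in \<open>g_h\<close>, since regularity
    of the solutions in the space variable has not been established.\<close>
  have g_cont: "continuous_on UNIV g"
    unfolding g_h[abs_def]
    by (intro continuous_intros continuous_on_compose2[OF h_cont]) auto
  have g_per: "g (t + T) = g t" for t
    using h_per[of "\<omega> * t"] omega by (simp add: g_h T algebra_simps)
  have lim: "(running_average G z x \<longlongrightarrow> 1 / complex_of_real T * integral {0..T} g) at_top"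
    unfolding running_average_def[abs_def] g_z
    by (rule running_average_periodic[OF g_cont g_per T_pos])
  then show "\<exists>L. (running_average G z x \<longlongrightarrow> L) at_top" by blast
  have E_g: "integral {0..T} (\<lambda>t. E * a x t * coupling_op G (\<lambda>y. cnj (a y t)) x)
      = E * integral {0..T} g"
    by (simp add: g_def[abs_def] mult.assoc)
  have "Lim at_top (running_average G z x) = 1 / complex_of_real T * integral {0..T} g"
    using lim by (intro tendsto_Lim) auto
  then show "effective_frequency G \<alpha> z x
      = - Im (1 / complex_of_real T * integral {0..T} (\<lambda>t.
            exp (\<i> * complex_of_real \<alpha>) * a x t * coupling_op G (\<lambda>y. cnj (a y t)) x))"
    unfolding effective_frequency_def E_def[symmetric] E_g by (simp add: mult.left_commute)
  \<comment> \<open>\<open>E\<close> meets the cnj E from \<open>g_h\<close>. Then 1 / T = \<omega>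
    / (2 * pi), the factor 2 * \<omega> and the 1 / \<omega> of the time change combine to 2 *
    \<omega> / (2 * pi).\<close>
  have "E * integral {0..T} g = 2 * of_real \<omega> * (E * cnj E) * integral {0..T} (\<lambda>t. h (\<omega> * t))"
    by (simp add: g_h[abs_def])
  also have "integral {0..T} (\<lambda>t. h (\<omega> * t)) = integral {0..2 * pi} h / of_real \<omega>"
    unfolding T by (rule integral_scaled_period[OF h_cont omega]) simp
  finally have "1 / complex_of_real T * (E * integral {0..T} g)
      = of_real (2 * \<omega>) * (1 / (2 * complex_of_real pi) * integral {0..2 * pi} h)"
    using omega by (simp add: E T)
  moreover have "Im (of_real r * c) = r * Im c" for r c by simp
  ultimately show "- Im (1 / complex_of_real T * integral {0..T} (\<lambda>t.
          exp (\<i> * complex_of_real \<alpha>) * a x t * coupling_op G (\<lambda>y. cnj (a y t)) x))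
      = - 2 * \<omega> * Im (1 / (2 * complex_of_real pi)
            * integral {0..2 * pi} (\<lambda>t. u x t * cnj (w x t)))"
    unfolding E_def[symmetric] E_g h_def[abs_def, symmetric]
    by (simp only:)
qed

end
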